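(* Let $(X,E,\ell)$ be a connected, locally finite, symmetric labelled graph with finite label alphabet $\Sigma$, and let $F\subset X$ be a finite, non-empty set of vertices. If $X$ is context-free with respect to $F$, then $L_{x,y}(X)$ is a context-free language for all $x,y\in X$. Furthermore, if the graph $X$ is deterministic, then the context-free language $L_{x,y}(X)$ is deterministic for all $x,y \in X$.
   Context: **Labelled graphs.** Let $\Sigma$ be a finite alphabet. A directed graph labelled by $\Sigma$ is a triple $(X,E,\ell)$, where $X$ is a finite or countable set of vertices, $E\subset X\times\Sigma\times X$ is the set of oriented labelled edges, and $\ell(x,a,y)=a$. An edge $(x,a,y)$ goes from $x$ to $y$ (loops, and multiple edges with different labels, are allowed). It is locally finite: every vertex is an endpoint of only finitely many edges. It is *deterministic* if at every vertex all outgoing edges have distinct labels. It is *symmetric* if there is an involution $a\mapsto a^{-1}$ of $\Sigma$ with $a^{-1}\neq a$ for all $a$, such that $(x,a,y)\in E$ implies $(y,a^{-1},x)\in E$. The label of a path $e_1\cdots e_n$ (consecutive edges, terminal vertex of $e_i$ = initial vertex of $e_{i+1}$) is the word $\ell(e_1)\cdots\ell(e_n)\in\Sigma^*$; the empty path at a vertex has label the empty word $\epsilon$. $L_{x,y}(X)\subset\Sigma^*$ is the set of labels of all paths from $x$ to $y$. The graph is connected if any two vertices are joined by a path; $d(x,y)$ is the minimal length of a path from $x$ to $y$. **Context-free graphs.** For finite non-empty $F\subset X$ and $n\ge 0$ let $B(F,n)=\{x: \min_{y\in F} d(x,y)\le n\}$. The *cones* of $X$ with respect to $F$ are the connected components of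 the induced graphs $X\setminus B(F,n)$, $n\ge 0$. The boundary $\partial C$ of a cone $C$ is the set of vertices of $C$ having a neighbour outside $C$. $X$ is *context-free with respect to $F$* if there are only finitely many isomorphism types of cones with respect to $F$, as labelled graphs with boundary (an isomorphism is a bijection of vertex sets $C\to C'$ that preserves labelled edges in both directions and maps $\partial C$ onto $\partial C'$). **Deterministic context-free languages.** A pushdown automaton is $(Q,\Sigma,Z,\delta,q_0,Q_f,z_0)$ with finite sets $Q$ (states), $\Sigma$ (input alphabet), $Z$ (stack symbols), $q_0\in Q$, $Q_f\subset Q$, $z_0\in Z$, and $\delta$ a map from $Q\times(\Sigma\cup\{\epsilon\})\times(Z\cup\{\epsilon\})$ to the finite subsets of $Q\times Z^*$. In state $p$, with top (rightmost) stack symbol $z$ (or $z=\epsilon$ if the stack is empty), it may choose $(q,\zeta')\in\delta(p,a,z)$, where $a$ is the next input letter, consume $a$, go to state $q$ and replace $z$ by $\zeta'$; or choose $(q,\zeta')\in\delta(p,\epsilon,z)$ and do the same without consuming input. A word is accepted if, starting in state $q_0$ with stack $z_0$, the automaton can reach after finitely many transitions a final state (in $Q_f$) with empty stack and with all input consumed. It is deterministic if $|\delta(p,a,z)|+|\delta(p,\epsilon,z)|\le 1$ for all $p\in Q$, $a\in\Sigma$, $z\in Z\cup\{\epsilon\}$. A language is context-free iff it is accepted by some pushdown automaton; a context-free language is *deterministic* if it is accepted by some deterministic pushdown automaton. *)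

theory Defs
  imports "HOL-Library.Countable_Set"
begin

section \<open>Labelled graphs\<close>

text \<open>An edge from \<open>x\<close> to \<open>y\<close> with label \<open>a\<close> is the triple \<open>(x, a, y)\<close>.\<close>

type_synonym ('v, 'a) edge = "'v \<times> 'a \<times> 'v"

definition source :: "('v, 'a) edge \<Rightarrow> 'v" where
  "source e = fst e"

definition label :: "('v, 'a) edge \<Rightarrow> 'a" where
  "label e = fst (snd e)"

definition target :: "('v, 'a) edge \<Rightarrow> 'v" where
  "target e = snd (snd e)"

locale labelled_graph =
  fixes \<Sigma> :: "'a set" and X :: "'v set" and E :: "('v, 'a) edge set"
  assumes finite_alphabet: "finite \<Sigma>"
    and countable_vertices: "countable X"
    and edges_subset: "E \<subseteq> X \<times> \<Sigma> \<times> X"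

definition locally_finite :: "'v set \<Rightarrow> ('v, 'a) edge set \<Rightarrow> bool" where
  "locally_finite X E \<longleftrightarrow> (\<forall>x\<in>X. finite {e \<in> E. source e = x \<or> target e = x})"

definition deterministic_graph :: "'v set \<Rightarrow> ('v, 'a) edge set \<Rightarrow> bool" where
  "deterministic_graph X E \<longleftrightarrow> (\<forall>x\<in>X. inj_on label {e \<in> E. source e = x})"

definition symmetric_graph :: "'a set \<Rightarrow> ('v, 'a) edge set \<Rightarrow> bool" where
  "symmetric_graph \<Sigma> E \<longleftrightarrow>
     (\<exists>i. (\<forall>a\<in>\<Sigma>. i a \<in> \<Sigma> \<and> i (i a) = a \<and> i a \<noteq> a) \<and>
          (\<forall>x a y. (x, a, y) \<in> E \<longrightarrow> (y, i a, x) \<in> E))"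

fun path :: "'v set \<Rightarrow> ('v, 'a) edge set \<Rightarrow> 'v \<Rightarrow> ('v, 'a) edge list \<Rightarrow> 'v \<Rightarrow> bool" where
  "path X E x [] y \<longleftrightarrow> x \<in> X \<and> x = y"
| "path X E x (e # es) y \<longleftrightarrow> e \<in> E \<and> source e = x \<and> path X E (target e) es y"

definition path_language :: "'v set \<Rightarrow> ('v, 'a) edge set \<Rightarrow> 'v \<Rightarrow> 'v \<Rightarrow> 'a list set" where
  "path_language X E x y = {map label es |es. path X E x es y}"

definition connected_graph :: "'v set \<Rightarrow> ('v, 'a) edge set \<Rightarrow> bool" where
  "connected_graph X E \<longleftrightarrow> (\<forall>x\<in>X. \<forall>y\<in>X. \<exists>es. path X E x es y)"

text \<open>The distance is only meaningful when a path from \<open>x\<close> to \<open>y\<close> exists,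
  in particular for vertices of a connected graph.\<close>

definition graph_dist :: "'v set \<Rightarrow> ('v, 'a) edge set \<Rightarrow> 'v \<Rightarrow> 'v \<Rightarrow> nat" where
  "graph_dist X E x y = (LEAST n. \<exists>es. path X E x es y \<and> length es = n)"


section \<open>Cones and context-free graphs\<close>

text \<open>The minimum is over a finite non-empty set when \<open>F\<close> is finite and non-empty.\<close>

definition graph_ball :: "'v set \<Rightarrow> ('v, 'a) edge set \<Rightarrow> 'v set \<Rightarrow> nat \<Rightarrow> 'v set" where
  "graph_ball X E F n = {x \<in> X. Min ((\<lambda>y. graph_dist X E x y) ` F) \<le> n}"

definition induced_edges :: "('v, 'a) edge set \<Rightarrow> 'v set \<Rightarrow> ('v, 'a) edge set" where
  "induced_edges E A = {e \<in> E. source e \<in> A \<and> target e \<in> A}"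

text \<open>Paths are directed; in a symmetric graph, being joined by a path inside \<open>A\<close> is
  nevertheless an equivalence relation on \<open>A\<close>.\<close>

definition components :: "('v, 'a) edge set \<Rightarrow> 'v set \<Rightarrow> 'v set set" where
  "components E A = A // {(x, y). \<exists>es. path A (induced_edges E A) x es y}"

definition cones :: "'v set \<Rightarrow> ('v, 'a) edge set \<Rightarrow> 'v set \<Rightarrow> 'v set set" where
  "cones X E F = (\<Union>n. components E (X - graph_ball X E F n))"

definition cone_boundary :: "'v set \<Rightarrow> ('v, 'a) edge set \<Rightarrow> 'v set \<Rightarrow> 'v set" where
  "cone_boundary X E C =
     {x \<in> C. \<exists>y\<in>X - C. \<exists>a. (x, a, y) \<in> E \<or> (y, a, x) \<in> E}"

definition cone_isomorphic :: "'v set \<Rightarrow> ('v, 'a) edge set \<Rightarrow> 'v set \<Rightarrow> 'v set \<Rightarrow> bool" where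
  "cone_isomorphic X E C C' \<longleftrightarrow>
     (\<exists>f. bij_betw f C C' \<and>
          (\<forall>x\<in>C. \<forall>y\<in>C. \<forall>a. (x, a, y) \<in> E \<longleftrightarrow> (f x, a, f y) \<in> E) \<and>
          f ` cone_boundary X E C = cone_boundary X E C')"

definition context_free_graph :: "'v set \<Rightarrow> ('v, 'a) edge set \<Rightarrow> 'v set \<Rightarrow> bool" where
  "context_free_graph X E F \<longleftrightarrow>
     finite (cones X E F //
       {(C, C'). C \<in> cones X E F \<and> C' \<in> cones X E F \<and> cone_isomorphic X E C C'})"


section \<open>Pushdown automata\<close>

text \<open>In the second and third argument of the transition function, \<open>None\<close> stands for the
  empty word: no input letter is read, respectively the stack is empty.\<close>

record ('q, 'a, 'z) pda =
  pda_states :: "'q set"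
  pda_alphabet :: "'a set"
  pda_stack_symbols :: "'z set"
  pda_delta :: "'q \<Rightarrow> 'a option \<Rightarrow> 'z option \<Rightarrow> ('q \<times> 'z list) set"
  pda_init :: 'q
  pda_final :: "'q set"
  pda_init_stack :: 'z

definition pda :: "('q, 'a, 'z) pda \<Rightarrow> bool" where
  "pda M \<longleftrightarrow>
     finite (pda_states M) \<and> finite (pda_alphabet M) \<and> finite (pda_stack_symbols M) \<and>
     pda_init M \<in> pda_states M \<and> pda_final M \<subseteq> pda_states M \<and>
     pda_init_stack M \<in> pda_stack_symbols M \<and>
     (\<forall>p \<in> pda_states M. \<forall>a \<in> insert None (Some ` pda_alphabet M).
        \<forall>z \<in> insert None (Some ` pda_stack_symbols M).
          finite (pda_delta M p a z) \<and>
          pda_delta M p a z \<subseteq> pda_states M \<times> lists (pda_stack_symbols M))"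

text \<open>Stacks are words whose top is the rightmost letter.\<close>

definition stack_top :: "'z list \<Rightarrow> 'z option" where
  "stack_top s = (if s = [] then None else Some (last s))"

text \<open>A configuration consists of the state, the remaining input and the stack. On the empty
  stack, \<open>butlast [] = []\<close>, so that a transition simply pushes its word.\<close>

inductive pda_step ::
  "('q, 'a, 'z) pda \<Rightarrow> 'q \<times> 'a list \<times> 'z list \<Rightarrow> 'q \<times> 'a list \<times> 'z list \<Rightarrow> bool"
  for M :: "('q, 'a, 'z) pda" where
  read: "(q, u) \<in> pda_delta M p (Some a) (stack_top s) \<Longrightarrow>
    pda_step M (p, a # w, s) (q, w, butlast s @ u)"
| silent: "(q, u) \<in> pda_delta M p None (stack_top s) \<Longrightarrow>
    pda_step M (p, w, s) (q, w, butlast s @ u)"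

definition pda_language :: "('q, 'a, 'z) pda \<Rightarrow> 'a list set" where
  "pda_language M =
     {w \<in> lists (pda_alphabet M).
        \<exists>q \<in> pda_final M. (pda_step M)\<^sup>*\<^sup>* (pda_init M, w, [pda_init_stack M]) (q, [], [])}"

definition deterministic_pda :: "('q, 'a, 'z) pda \<Rightarrow> bool" where
  "deterministic_pda M \<longleftrightarrow>
     (\<forall>p \<in> pda_states M. \<forall>a \<in> pda_alphabet M.
        \<forall>z \<in> insert None (Some ` pda_stack_symbols M).
          card (pda_delta M p (Some a) z) + card (pda_delta M p None z) \<le> 1)"

text \<open>States and stack symbols are taken in \<open>nat\<close>, without loss of generality since both
  sets are finite.\<close>

definition context_free_language :: "'a set \<Rightarrow> 'a list set \<Rightarrow> bool" where
  "context_free_language \<Sigma> L \<longleftrightarrow>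
     (\<exists>M :: (nat, 'a, nat) pda. pda M \<and> pda_alphabet M = \<Sigma> \<and> pda_language M = L)"

definition deterministic_context_free_language :: "'a set \<Rightarrow> 'a list set \<Rightarrow> bool" where
  "deterministic_context_free_language \<Sigma> L \<longleftrightarrow>
     (\<exists>M :: (nat, 'a, nat) pda.
        pda M \<and> deterministic_pda M \<and> pda_alphabet M = \<Sigma> \<and> pda_language M = L)"

end

theory Submission
  imports Defs
begin

text \<open>
  Fix \<open>x\<close>, \<open>y\<close> and a ball \<open>B\<close> around \<open>F\<close> containing both. A vertex outside \<open>B\<close> lies on the
  boundary of the last cone in a finite chain of nested cones that starts with a component of the
  complement of \<open>B\<close>. One representative is chosen for every isomorphism type of cones, together with
  isomorphisms to the representatives. The chain is stored on the stack: the lowest entry is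
  a component of the complement of \<open>B\<close>, every other entry is a cone inside the representative of the
  entry below, and the state is a boundary vertex of the representative of the top entry (or a vertex
  of \<open>B\<close> if the stack is empty). An edge of the graph enters a smaller cone (push), stays on
  a boundary, or leaves the current cone (pop), so that transitions correspond exactly to edges, and
  determinism is inherited from the graph. Since \<open>y\<close> belongs to \<open>B\<close>, it is
  represented only by the state \<open>y\<close> with empty stack.
\<close>

section \<open>Renaming states and stack symbols\<close>

lemma stack_top_simps [simp]:
  "stack_top [] = None" "stack_top (s @ [z]) = Some z"
  by (simp_all add: stack_top_def)

lemma stack_top_map: "stack_top (map h s) = map_option h (stack_top s)"
  by (simp add: stack_top_def last_map)

text \<open>The automaton of a graph has vertices as states and cones as stack symbols, while the
  notion of a context-free language fixes \<open>nat\<close> for both. Injections of the finite sets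
  involved carry it over: steps from encoded configurations correspond in both directions, and the
  images of transition sets are no larger, which keeps determinism.\<close>

lemma pda_encode_nat:
  fixes M :: "('q, 'a, 'z) pda"
  assumes M: "pda M"
  shows "\<exists>N :: (nat, 'a, nat) pda. pda N \<and> pda_alphabet N = pda_alphabet M \<and>
    pda_language N = pda_language M \<and> (deterministic_pda M \<longrightarrow> deterministic_pda N)"
proof -
  define Q where "Q = pda_states M"
  define A where "A = pda_alphabet M"
  define Z where "Z = pda_stack_symbols M"
  have fin: "finite Q" "finite A" "finite Z" using M by (auto simp: pda_def Q_def A_def Z_def)
  have delta: "finite (pda_delta M p a t)" "pda_delta M p a t \<subseteq> Q \<times> lists Z"
    if "p \<in> Q" "a \<in> insert None (Some ` A)" "t \<in> insert None (Some ` Z)" for p a t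
    using M that unfolding pda_def Q_def A_def Z_def by blast+
  obtain f :: "'q \<Rightarrow> nat" where f: "inj_on f Q"
    using finite_imp_inj_to_nat_seg[OF fin(1)] by blast
  obtain h :: "'z \<Rightarrow> nat" where h: "inj_on h Z"
    using finite_imp_inj_to_nat_seg[OF fin(3)] by blast
  define N :: "(nat, 'a, nat) pda" where
    "N = \<lparr>pda_states = f ` Q, pda_alphabet = A, pda_stack_symbols = h ` Z,
      pda_delta = (\<lambda>p a t. map_prod f (map h) `
        pda_delta M (inv_into Q f p) a (map_option (inv_into Z h) t)),
      pda_init = f (pda_init M), pda_final = f ` pda_final M,
      pda_init_stack = h (pda_init_stack M)\<rparr>"
  have deltaN: "pda_delta N (f p) a (map_option h t) = map_prod f (map h) ` pda_delta M p a t"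
    if "p \<in> Q" "t \<in> insert None (Some ` Z)" for p a t
    using that f h by (auto simp: N_def)
  have tops: "\<exists>t' \<in> insert None (Some ` Z). t = map_option h t'"
    if "t \<in> insert None (Some ` pda_stack_symbols N)" for t
    using that by (force simp: N_def)
  have pdaN: "pda N"
    unfolding pda_def
  proof (intro conjI ballI)
    fix p a t
    assume "p \<in> pda_states N" and a: "a \<in> insert None (Some ` pda_alphabet N)"
      and t: "t \<in> insert None (Some ` pda_stack_symbols N)"
    then obtain p' where p': "p = f p'" "p' \<in> Q" by (auto simp: N_def)
    from tops[OF t] obtain t' where t': "t = map_option h t'" "t' \<in> insert None (Some ` Z)" by blast
    have a': "a \<in> insert None (Some ` A)" using a by (simp add: N_def)
    show "finite (pda_delta N p a t)"
      using deltaN[OF p'(2) t'(2)] delta(1)[OF p'(2) a' t'(2)] p' t' by simp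
    show "pda_delta N p a t \<subseteq> pda_states N \<times> lists (pda_stack_symbols N)"
    proof -
      have "map_prod f (map h) ` (Q \<times> lists Z) \<subseteq> pda_states N \<times> lists (pda_stack_symbols N)"
        by (auto simp: N_def)
      then show ?thesis
        using image_mono[OF delta(2)[OF p'(2) a' t'(2)]] unfolding p'(1) t'(1) deltaN[OF p'(2) t'(2)]
        by (rule order_trans[rotated])
    qed
  qed (use M fin in \<open>auto simp: N_def pda_def Q_def Z_def\<close>)
  \<comment> \<open>The injections can be inverted only on \<open>Q\<close> and \<open>Z\<close>, so
    the simulation is confined to configurations over \<open>Q\<close>, \<open>A\<close> and
    \<open>Z\<close>, a property preserved by the steps of \<open>M\<close>.\<close>
  define good where "good = (\<lambda>(p, w, s). p \<in> Q \<and> w \<in> lists A \<and> s \<in> lists Z)"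
  define enc where "enc = (\<lambda>(p, w :: 'a list, s). (f p, w, map h s))"
  have top: "stack_top s \<in> insert None (Some ` Z)" if "s \<in> lists Z" for s
    using that by (auto simp: stack_top_def)
  have butl: "butlast s \<in> lists Z" if "s \<in> lists Z" for s
    using that by (auto dest: in_set_butlastD)
  have step1: "good c' \<and> pda_step N (enc c) (enc c')" if "pda_step M c c'" "good c" for c c'
    using that
  proof cases
    case (read q u p a s w)
    have g: "p \<in> Q" "a \<in> A" "w \<in> lists A" "s \<in> lists Z"
      using that(2) read by (auto simp: good_def)
    have "(q, u) \<in> Q \<times> lists Z" using delta(2)[OF g(1) _ top[OF g(4)], of "Some a"] read g by auto
    moreover have "(f q, map h u) \<in> pda_delta N (f p) (Some a) (stack_top (map h s))"
      using deltaN[OF g(1) top[OF g(4)]] read(3) by (force simp: stack_top_map)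
    ultimately show ?thesis using read g butl[OF g(4)] pda_step.read[of _ _ N]
      by (auto simp: good_def enc_def map_butlast)
  next
    case (silent q u p s w)
    have g: "p \<in> Q" "w \<in> lists A" "s \<in> lists Z"
      using that(2) silent by (auto simp: good_def)
    have "(q, u) \<in> Q \<times> lists Z" using delta(2)[OF g(1) _ top[OF g(3)], of "None"] silent g by auto
    moreover have "(f q, map h u) \<in> pda_delta N (f p) None (stack_top (map h s))"
      using deltaN[OF g(1) top[OF g(3)]] silent(3) by (force simp: stack_top_map)
    ultimately show ?thesis using silent g butl[OF g(3)] pda_step.silent[of _ _ N]
      by (auto simp: good_def enc_def map_butlast)
  qed
  have step2: "\<exists>c'. d = enc c' \<and> pda_step M c c'" if "pda_step N (enc c) d" "good c" for c d
  proof -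
    obtain p w s where c: "c = (p, w, s)" by (cases c)
    have g: "p \<in> Q" "w \<in> lists A" "s \<in> lists Z" using that(2) c by (auto simp: good_def)
    note eq = deltaN[OF g(1) top[OF g(3)]]
    from that(1) show ?thesis
    proof cases
      case (read q u p' a s' w')
      then obtain q0 u0 where "(q0, u0) \<in> pda_delta M p (Some a) (stack_top s)" "q = f q0" "u = map h u0"
        using c eq[of "Some a"] by (auto simp: enc_def stack_top_map)
      then show ?thesis using read c pda_step.read[of q0 u0 M p a s w']
        by (intro exI[of _ "(q0, w', butlast s @ u0)"]) (auto simp: enc_def map_butlast)
    next
      case (silent q u p' s' w')
      then obtain q0 u0 where "(q0, u0) \<in> pda_delta M p None (stack_top s)" "q = f q0" "u = map h u0"
        using c eq[of None] by (auto simp: enc_def stack_top_map)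
      then show ?thesis using silent c pda_step.silent[of q0 u0 M p s w']
        by (intro exI[of _ "(q0, w', butlast s @ u0)"]) (auto simp: enc_def map_butlast)
    qed
  qed
  have run1: "good c' \<and> (pda_step N)\<^sup>*\<^sup>* (enc c) (enc c')" if "(pda_step M)\<^sup>*\<^sup>* c c'" "good c" for c c'
    using that by (induction rule: rtranclp_induct) (auto dest: step1 intro: rtranclp.rtrancl_into_rtrancl)
  have run2: "\<exists>c'. d = enc c' \<and> good c' \<and> (pda_step M)\<^sup>*\<^sup>* c c'"
    if "(pda_step N)\<^sup>*\<^sup>* (enc c) d" "good c" for c d
    using that
  proof (induction rule: rtranclp_induct)
    case base
    then show ?case by blast
  next
    case (step d e)
    then obtain c' where c': "d = enc c'" "good c'" "(pda_step M)\<^sup>*\<^sup>* c c'" by blast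
    with step2[of c' e] step(2) obtain c'' where "e = enc c''" "pda_step M c' c''" by blast
    with c' step1[of c' c''] show ?case by (blast intro: rtranclp.rtrancl_into_rtrancl)
  qed
  have init: "good (pda_init M, w, [pda_init_stack M])" if "w \<in> lists A" for w
    using M that by (auto simp: good_def pda_def Q_def Z_def)
  have finalQ: "pda_final M \<subseteq> Q" using M by (simp add: pda_def Q_def)
  have encinit: "enc (pda_init M, w, [pda_init_stack M]) = (pda_init N, w, [pda_init_stack N])" for w
    by (simp add: enc_def N_def)
  have "w \<in> pda_language N \<longleftrightarrow> w \<in> pda_language M" for w
  proof
    assume "w \<in> pda_language N"
    then obtain q where w: "w \<in> lists A" and q: "q \<in> pda_final M"
      and run: "(pda_step N)\<^sup>*\<^sup>* (enc (pda_init M, w, [pda_init_stack M])) (f q, [], [])"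
      by (auto simp: pda_language_def encinit) (auto simp: N_def)
    from run2[OF run init[OF w]] obtain q' where "q' \<in> Q" "f q' = f q"
      "(pda_step M)\<^sup>*\<^sup>* (pda_init M, w, [pda_init_stack M]) (q', [], [])"
      by (auto simp: enc_def good_def)
    moreover from this have "q' = q" using f q finalQ by (auto dest: inj_onD)
    ultimately show "w \<in> pda_language M" using w q by (auto simp: pda_language_def A_def)
  next
    assume "w \<in> pda_language M"
    then obtain q where w: "w \<in> lists A" and q: "q \<in> pda_final M"
      and run: "(pda_step M)\<^sup>*\<^sup>* (pda_init M, w, [pda_init_stack M]) (q, [], [])"
      by (auto simp: pda_language_def A_def)
    from run1[OF run init[OF w]] have "(pda_step N)\<^sup>*\<^sup>* (pda_init N, w, [pda_init_stack N]) (f q, [], [])"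
      unfolding encinit by (simp add: enc_def)
    then show "w \<in> pda_language N" using w q by (auto simp: pda_language_def N_def)
  qed
  moreover have "deterministic_pda N" if det: "deterministic_pda M"
    unfolding deterministic_pda_def
  proof (intro ballI)
    fix p a t
    assume "p \<in> pda_states N" and a: "a \<in> pda_alphabet N"
      and t: "t \<in> insert None (Some ` pda_stack_symbols N)"
    then obtain p' where p': "p = f p'" "p' \<in> Q" by (auto simp: N_def)
    from tops[OF t] obtain t' where t': "t = map_option h t'" "t' \<in> insert None (Some ` Z)" by blast
    have "a \<in> A" using a by (simp add: N_def)
    then have "card (pda_delta M p' (Some a) t') + card (pda_delta M p' None t') \<le> 1"
      using det p' t' unfolding deterministic_pda_def A_def Q_def Z_def by blast
    moreover have "card (pda_delta N p b t) \<le> card (pda_delta M p' b t')"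
      if "b \<in> insert None (Some ` A)" for b
      using deltaN[OF p'(2) t'(2)] delta(1)[OF p'(2) that t'(2)] p'(1) t'(1) by (simp add: card_image_le)
    ultimately show "card (pda_delta N p (Some a) t) + card (pda_delta N p None t) \<le> 1"
      using \<open>a \<in> A\<close> by (meson add_mono image_eqI insertCI le_trans)
  qed
  moreover have "pda_alphabet N = pda_alphabet M" by (simp add: N_def A_def)
  ultimately show ?thesis using pdaN by blast
qed

section \<open>The automaton of a system of nested regions\<close>

text \<open>
  The index \<open>None\<close> of \<open>region\<close> and \<open>border\<close> is the empty stack (the whole graph with border \<open>B\<close>);
  \<open>Some z\<close> is the representative of the type of \<open>z\<close>, which \<open>emb z\<close> maps onto the cone \<open>z\<close>.
\<close>

locale nested_regions =
  fixes \<Sigma> :: "'a set" and X :: "'v set" and E :: "('v, 'a) edge set" and Z :: "'z set"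
    and region border :: "'z option \<Rightarrow> 'v set"
    and emb :: "'z \<Rightarrow> 'v \<Rightarrow> 'v"
    and child :: "'z option \<Rightarrow> 'v \<Rightarrow> 'z"
    and bottom :: 'z
  assumes finite_alphabet: "finite \<Sigma>"
    and edges: "E \<subseteq> X \<times> \<Sigma> \<times> X"
    and finite_out: "finite {w. (u, a, w) \<in> E}"
    and finite_symbols: "finite Z"
    and bottom: "bottom \<notin> Z"
    and region_None: "region None = X"
    and finite_border: "t \<in> insert None (Some ` Z) \<Longrightarrow> finite (border t)"
    and border_subset: "t \<in> insert None (Some ` Z) \<Longrightarrow> border t \<subseteq> region t"
    and interior: "t \<in> insert None (Some ` Z) \<Longrightarrow> u \<in> region t - border t \<Longrightarrow>
      (u, a, w) \<in> E \<Longrightarrow> w \<in> region t"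
    and emb_edge: "z \<in> Z \<Longrightarrow> v \<in> region (Some z) \<Longrightarrow> w \<in> region (Some z) \<Longrightarrow>
      (emb z v, a, emb z w) \<in> E \<longleftrightarrow> (v, a, w) \<in> E"
    and emb_border: "z \<in> Z \<Longrightarrow> v \<in> region (Some z) \<Longrightarrow> y \<notin> emb z ` region (Some z) \<Longrightarrow>
      (emb z v, a, y) \<in> E \<or> (y, a, emb z v) \<in> E \<Longrightarrow> v \<in> border (Some z)"
    and child: "t \<in> insert None (Some ` Z) \<Longrightarrow> v \<in> border t \<Longrightarrow> (v, a, w) \<in> E \<Longrightarrow>
      w \<in> region t - border t \<Longrightarrow>
      child t w \<in> Z \<and> w \<in> emb (child t w) ` region (Some (child t w)) \<and>
      emb (child t w) ` region (Some (child t w)) \<subseteq> region t - border t \<and>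
      (\<forall>u b y. u \<in> emb (child t w) ` region (Some (child t w)) \<longrightarrow> (u, b, y) \<in> E \<longrightarrow>
        y \<notin> emb (child t w) ` region (Some (child t w)) \<longrightarrow> y \<in> border t)"
begin

section \<open>Stacks as chains of nested cells, and edges seen from them\<close>

abbreviation cell :: "'z \<Rightarrow> 'v set" where
  "cell z \<equiv> emb z ` region (Some z)"

text \<open>The condition for placing \<open>z\<close> on top of \<open>t\<close>. By the second
  clause, a vertex reached by leaving the cell lies on the border of the region below, so popping a
  single symbol restores a legal state.\<close>

definition nested :: "'z option \<Rightarrow> 'z \<Rightarrow> bool" where
  "nested t z \<longleftrightarrow> cell z \<subseteq> region t - border t \<and>
     (\<forall>u b y. u \<in> cell z \<longrightarrow> (u, b, y) \<in> E \<longrightarrow> y \<notin> cell z \<longrightarrow> y \<in> border t)"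

inductive wf_stack :: "'z list \<Rightarrow> bool" where
  Nil: "wf_stack []"
| snoc: "wf_stack s \<Longrightarrow> z \<in> Z \<Longrightarrow> nested (stack_top s) z \<Longrightarrow> wf_stack (s @ [z])"

lemma wf_stack_symbols: "wf_stack s \<Longrightarrow> set s \<subseteq> Z"
  by (induction rule: wf_stack.induct) auto

lemma wf_stack_top: "wf_stack s \<Longrightarrow> stack_top s \<in> insert None (Some ` Z)"
  by (induction rule: wf_stack.induct) auto

lemma wf_stack_butlast: "wf_stack (s @ [z]) \<Longrightarrow> wf_stack s \<and> z \<in> Z \<and> nested (stack_top s) z"
  by (erule wf_stack.cases) auto

text \<open>This is the vertex of \<open>X\<close> encoded by state \<open>v\<close> and stack
  \<open>s\<close>. The top of the stack is the end of the list, so \<open>foldr\<close> applies its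
  embedding first and that of the lowest entry last.\<close>

definition position :: "'z list \<Rightarrow> 'v \<Rightarrow> 'v" where
  "position s v = foldr emb s v"

lemma position_Nil [simp]: "position [] v = v"
  and position_snoc [simp]: "position (s @ [z]) v = position s (emb z v)"
  by (simp_all add: position_def)

text \<open>Each \<open>emb z\<close> preserves and reflects edges, and nesting keeps its image
  within the region below, so the equivalence passes down the stack one entry at a time.\<close>

lemma position_edge:
  assumes "wf_stack s" "v \<in> region (stack_top s)" "w \<in> region (stack_top s)"
  shows "(position s v, a, position s w) \<in> E \<longleftrightarrow> (v, a, w) \<in> E"
  using assms
proof (induction arbitrary: v w rule: wf_stack.induct)
  case (snoc s z)
  then have "emb z v \<in> region (stack_top s)" "emb z w \<in> region (stack_top s)"
    by (auto simp: nested_def)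
  then show ?case using snoc by (simp add: emb_edge)
qed simp

text \<open>By induction the edge is already visible in the region below, because a cell avoids the
  border there. If its end were outside the top cell, \<open>emb_border\<close> would put
  \<open>v\<close> on the border.\<close>

lemma position_interior:
  assumes "wf_stack s" "v \<in> region (stack_top s) - border (stack_top s)" "(position s v, a, y) \<in> E"
  shows "\<exists>w \<in> region (stack_top s). y = position s w \<and> (v, a, w) \<in> E"
  using assms
proof (induction arbitrary: v rule: wf_stack.induct)
  case Nil
  then show ?case using edges region_None by auto
next
  case (snoc s z)
  then have "emb z v \<in> region (stack_top s) - border (stack_top s)" by (auto simp: nested_def)
  with snoc obtain w where w: "w \<in> region (stack_top s)" "y = position s w" "(emb z v, a, w) \<in> E"
    by fastforce
  have "w \<in> cell z" using emb_border[of z v w a] w snoc by auto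
  then show ?case using w snoc emb_edge by auto
qed

text \<open>The cell of the lowest entry avoids \<open>border None\<close>, and all higher entries
  lie inside that cell. This forces the empty stack when a path ends at a vertex of
  \<open>border None\<close>.\<close>

lemma position_cell:
  assumes "wf_stack s" "v \<in> region (stack_top s)"
  shows "s = [] \<or> position s v \<notin> border None"
  using assms
proof (induction arbitrary: v rule: wf_stack.induct)
  case (snoc s z)
  then have "emb z v \<in> region (stack_top s) - border (stack_top s)" by (auto simp: nested_def)
  with snoc.IH[of "emb z v"] show ?case by auto
qed simp

text \<open>
  \<open>pull t v\<close> is the current vertex seen from one level further down the stack, where all its
  neighbours are visible; \<open>move\<close> and \<open>descend\<close> return a neighbour to normal form, giving
  the new state and the word replacing the top of the stack.
\<close>

definition descend :: "'z option \<Rightarrow> 'v \<Rightarrow> 'v \<times> 'z list" where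
  "descend t w = (if w \<in> border t then (w, [])
     else (inv_into (region (Some (child t w))) (emb (child t w)) w, [child t w]))"

text \<open>If \<open>w\<close> is off the border, the child cell contains \<open>w\<close> but,
  avoiding the border, not \<open>v\<close>. The edge therefore enters the cell from outside, and
  \<open>emb_border\<close> puts the preimage of \<open>w\<close> on the border of the new top
  region.\<close>

lemma descend:
  assumes s: "wf_stack s" and v: "v \<in> border (stack_top s)" and e: "(v, a, w) \<in> E"
    and w: "w \<in> region (stack_top s)" and d: "descend (stack_top s) w = (q, u)"
  shows "wf_stack (s @ u)" "q \<in> border (stack_top (s @ u))" "position (s @ u) q = position s w"
proof -
  have "wf_stack (s @ u) \<and> q \<in> border (stack_top (s @ u)) \<and> position (s @ u) q = position s w"
  proof (cases "w \<in> border (stack_top s)")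
    case True
    then show ?thesis using d s by (auto simp: descend_def)
  next
    case False
    define z where "z = child (stack_top s) w"
    have z: "z \<in> Z" "w \<in> cell z" "nested (stack_top s) z"
      using child[OF wf_stack_top[OF s] v e] False w unfolding z_def nested_def by blast+
    have q: "q = inv_into (region (Some z)) (emb z) w" "u = [z]"
      using d False by (auto simp: descend_def z_def)
    have q': "q \<in> region (Some z)" "emb z q = w" unfolding q using z(2)
      by (auto intro: inv_into_into f_inv_into_f)
    have "v \<notin> cell z" using z(3) v by (auto simp: nested_def)
    then have "q \<in> border (Some z)" using emb_border[OF z(1) q'(1)] e q'(2) by blast
    then show ?thesis using q q' z s by (auto intro: wf_stack.snoc)
  qed
  then show "wf_stack (s @ u)" "q \<in> border (stack_top (s @ u))" "position (s @ u) q = position s w"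
    by auto
qed

definition pull :: "'z option \<Rightarrow> 'v \<Rightarrow> 'v" where
  "pull t v = (case t of None \<Rightarrow> v | Some z \<Rightarrow> emb z v)"

definition move :: "'z option \<Rightarrow> 'v \<Rightarrow> 'v \<times> 'z list" where
  "move t w = (case t of None \<Rightarrow> descend None w
     | Some z \<Rightarrow> if w \<in> cell z
         then map_prod id ((#) z) (descend t (inv_into (region t) (emb z) w)) else (w, []))"

text \<open>For a non-empty stack the pulled vertex is interior one level down, so the edge lies in
  that region and \<open>position_edge\<close> carries it to the graph. If \<open>w\<close> is in
  the top cell, it is pulled back through \<open>emb z\<close> and \<open>descend\<close> applies
  above the kept symbol; otherwise nesting puts \<open>w\<close> on the border below and the top
  symbol is dropped.\<close>

lemma move:
  assumes s: "wf_stack s" and v: "v \<in> border (stack_top s)"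
    and e: "(pull (stack_top s) v, a, w) \<in> E" and d: "move (stack_top s) w = (q, u)"
  shows "wf_stack (butlast s @ u) \<and> q \<in> border (stack_top (butlast s @ u)) \<and>
    position (butlast s @ u) q = position (butlast s) w \<and>
    (position s v, a, position (butlast s) w) \<in> E"
proof (cases s rule: rev_cases)
  case Nil
  have "w \<in> X" using e edges by auto
  then show ?thesis using descend[OF s v, of a w q u] e d Nil
    by (auto simp: pull_def move_def region_None)
next
  case (snoc s' z)
  have s': "wf_stack s'" "z \<in> Z" "nested (stack_top s') z" using wf_stack_butlast s snoc by auto
  have v': "v \<in> region (Some z)" using v border_subset s'(2) snoc by auto
  then have "emb z v \<in> region (stack_top s') - border (stack_top s')"
    using s'(3) by (auto simp: nested_def)
  moreover from this have "w \<in> region (stack_top s')"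
    using interior[OF wf_stack_top[OF s'(1)]] e snoc by (auto simp: pull_def)
  ultimately have edge: "(position s v, a, position (butlast s) w) \<in> E"
    using position_edge[OF s'(1), of "emb z v" w a] e snoc by (auto simp: pull_def)
  show ?thesis
  proof (cases "w \<in> cell z")
    case True
    define w' where "w' = inv_into (region (Some z)) (emb z) w"
    have w': "w' \<in> region (Some z)" "emb z w' = w" unfolding w'_def using True
      by (auto intro: inv_into_into f_inv_into_f)
    obtain u' where u': "descend (Some z) w' = (q, u')" "u = z # u'"
      using d snoc True by (cases "descend (Some z) w'") (auto simp: move_def w'_def)
    have "(v, a, w') \<in> E" using e w' v' s'(2) snoc emb_edge by (auto simp: pull_def)
    then show ?thesis using descend[OF s v, of a w' q u'] u' w' edge snoc by auto
  next
    case False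
    then have "w \<in> border (stack_top s')" using s'(3) e v' snoc by (auto simp: nested_def pull_def)
    then show ?thesis using d False snoc s' edge by (auto simp: move_def)
  qed
qed

text \<open>No edge of the graph is missed: one level down the current vertex is interior, so
  \<open>position_interior\<close> finds all its successors there.\<close>

lemma move_complete:
  assumes s: "wf_stack s" and v: "v \<in> border (stack_top s)" and e: "(position s v, a, y) \<in> E"
  shows "\<exists>w. (pull (stack_top s) v, a, w) \<in> E \<and> position (butlast s) w = y"
proof (cases s rule: rev_cases)
  case Nil
  then show ?thesis using e by (auto simp: pull_def)
next
  case (snoc s' z)
  have s': "wf_stack s'" "z \<in> Z" "nested (stack_top s') z" using wf_stack_butlast s snoc by auto
  have "v \<in> region (Some z)" using v border_subset s'(2) snoc by auto
  then have "emb z v \<in> region (stack_top s') - border (stack_top s')"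
    using s'(3) by (auto simp: nested_def)
  from position_interior[OF s'(1) this] e snoc show ?thesis by (auto simp: pull_def)
qed

section \<open>The pushdown automaton and its single steps\<close>

definition states :: "'v set" where
  "states = (\<Union>t \<in> insert None (Some ` Z). border t)"

text \<open>A run must begin with one symbol on the stack, whereas \<open>x\<close> is represented
  with the empty stack; \<open>bottom\<close> exists to be removed by the only silent transition.
  Intersecting with \<open>states \<times> lists Z\<close> makes the transitions well-typed even for
  a state and a top symbol that do not fit together.\<close>

definition automaton :: "'v \<Rightarrow> 'v \<Rightarrow> ('v, 'a, 'z) pda" where
  "automaton x y = \<lparr>pda_states = states, pda_alphabet = \<Sigma>, pda_stack_symbols = insert bottom Z,
     pda_delta = (\<lambda>p a t. if t = Some bottom then (if p = x \<and> a = None then {(x, [])} else {})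
       else case a of None \<Rightarrow> {}
       | Some b \<Rightarrow> move t ` {w. (pull t p, b, w) \<in> E} \<inter> states \<times> lists Z),
     pda_init = x, pda_final = {y}, pda_init_stack = bottom\<rparr>"

lemma pda_automaton:
  assumes "x \<in> border None" "y \<in> border None"
  shows "pda (automaton x y)"
proof -
  have fin: "finite states" using finite_border finite_symbols by (auto simp: states_def)
  have xy: "x \<in> states" "y \<in> states" using assms by (auto simp: states_def)
  have delta: "finite (pda_delta (automaton x y) p a t) \<and>
      pda_delta (automaton x y) p a t \<subseteq> states \<times> lists (insert bottom Z)" for p a t
  proof (cases "t = Some bottom")
    case True
    then show ?thesis using xy by (simp add: automaton_def)
  next
    case False
    have "lists Z \<subseteq> lists (insert bottom Z)" by (rule lists_mono) auto
    then show ?thesis using finite_out False by (cases a) (auto simp: automaton_def)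
  qed
  have sel: "pda_states (automaton x y) = states" "pda_alphabet (automaton x y) = \<Sigma>"
    "pda_stack_symbols (automaton x y) = insert bottom Z" "pda_init (automaton x y) = x"
    "pda_final (automaton x y) = {y}" "pda_init_stack (automaton x y) = bottom"
    by (simp_all add: automaton_def)
  show ?thesis
    unfolding pda_def sel using finite_alphabet finite_symbols fin xy delta
    by (intro conjI ballI) simp_all
qed

text \<open>On \<open>bottom\<close> nothing is read, and elsewhere there is no silent transition.
  The reading transitions come from the successors of a single vertex along a single label, of which
  there is at most one.\<close>

lemma deterministic_automaton:
  assumes det: "\<And>u a w w'. (u, a, w) \<in> E \<Longrightarrow> (u, a, w') \<in> E \<Longrightarrow> w = w'"
  shows "deterministic_pda (automaton x y)"
proof -
  have "card (move t ` {w. (pull t p, b, w) \<in> E} \<inter> states \<times> lists Z) \<le> 1" for t p b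
  proof -
    define W where "W = {w. (pull t p, b, w) \<in> E}"
    have W: "finite W" using finite_out by (simp add: W_def)
    have "card (move t ` W \<inter> states \<times> lists Z) \<le> card (move t ` W)"
      using W by (intro card_mono) auto
    also have "\<dots> \<le> card W" using W by (rule card_image_le)
    also have "\<dots> \<le> Suc 0"
      unfolding card_le_Suc0_iff_eq[OF W] using det[of "pull t p" b] by (simp add: W_def)
    finally show ?thesis by (simp add: W_def)
  qed
  then show ?thesis by (auto simp: deterministic_pda_def automaton_def)
qed

text \<open>Since \<open>bottom\<close> lies outside \<open>Z\<close>, it never tops a well-formed
  stack; only reading transitions apply, and these are governed by \<open>move\<close>.\<close>

lemma automaton_step_sound:
  assumes s: "wf_stack s" and v: "v \<in> border (stack_top s)"
    and st: "pda_step (automaton x y) (v, w, s) c"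
  obtains a w' q s' where "w = a # w'" "c = (q, w', s')" "wf_stack s'" "q \<in> border (stack_top s')"
    "(position s v, a, position s' q) \<in> E"
proof -
  have nb: "stack_top s \<noteq> Some bottom" using wf_stack_top[OF s] bottom by auto
  from st show ?thesis
  proof cases
    case (read q u a w')
    then obtain y' where y': "(pull (stack_top s) v, a, y') \<in> E" "move (stack_top s) y' = (q, u)"
      using nb by (auto simp: automaton_def)
    from move[OF s v this] show ?thesis using that read by auto
  next
    case silent
    then show ?thesis using nb by (auto simp: automaton_def)
  qed
qed

lemma automaton_step_complete:
  assumes s: "wf_stack s" and v: "v \<in> border (stack_top s)" and e: "(position s v, a, y') \<in> E"
  obtains q s' where "pda_step (automaton x y) (v, a # w, s) (q, w, s')" "wf_stack s'"
    "q \<in> border (stack_top s')" "position s' q = y'"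
proof -
  have nb: "stack_top s \<noteq> Some bottom" using wf_stack_top[OF s] bottom by auto
  obtain w' where w': "(pull (stack_top s) v, a, w') \<in> E" "position (butlast s) w' = y'"
    using move_complete[OF s v e] by auto
  obtain q u where qu: "move (stack_top s) w' = (q, u)" by fastforce
  note m = move[OF s v w'(1) qu]
  \<comment> \<open>The intersection in the transition function discards nothing here: by
    \<open>move\<close>, the new stack is well-formed and the new state lies on the border of its
    top.\<close>
  have "q \<in> states" using m wf_stack_top[of "butlast s @ u"] unfolding states_def by blast
  moreover have "u \<in> lists Z" using m wf_stack_symbols[of "butlast s @ u"] by auto
  moreover have "(q, u) \<in> move (stack_top s) ` {w. (pull (stack_top s) v, a, w) \<in> E}"
    using w' qu by force
  ultimately have "pda_step (automaton x y) (v, a # w, s) (q, w, butlast s @ u)"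
    using nb by (intro pda_step.read) (auto simp: automaton_def)
  then show ?thesis using that m w' by auto
qed

section \<open>Runs of the automaton and paths of the graph\<close>

lemma automaton_run_sound:
  assumes "(pda_step (automaton x y))\<^sup>*\<^sup>* (v, w, s) (y, [], [])"
    and "wf_stack s" "v \<in> border (stack_top s)"
  shows "\<exists>es. path X E (position s v) es y \<and> map label es = w"
  using assms
proof (induction "(v, w, s)" arbitrary: v w s rule: converse_rtranclp_induct)
  case base
  then have "y \<in> X" using border_subset[of None] region_None by auto
  then show ?case by (intro exI[of _ "[]"]) simp
next
  case (step c)
  from automaton_step_sound[OF step(4,5,1)] obtain a w' q s' where
    c: "w = a # w'" "c = (q, w', s')" "wf_stack s'" "q \<in> border (stack_top s')"
    "(position s v, a, position s' q) \<in> E" .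
  from step(3)[OF c(2-4)] obtain es where "path X E (position s' q) es y" "map label es = w'" by auto
  with c show ?case
    by (intro exI[of _ "(position s v, a, position s' q) # es"])
      (auto simp: source_def target_def label_def)
qed

lemma automaton_run_complete:
  assumes "path X E (position s v) es y" "wf_stack s" "v \<in> border (stack_top s)" "y \<in> border None"
  shows "(pda_step (automaton x y))\<^sup>*\<^sup>* (v, map label es, s) (y, [], [])"
  using assms
proof (induction es arbitrary: v s)
  case Nil
  \<comment> \<open>The path is empty, so \<open>position s v\<close> is \<open>y\<close>, a vertex
    of \<open>border None\<close>; \<open>position_cell\<close> then makes the stack empty, as
    acceptance requires.\<close>
  then have "v \<in> region (stack_top s)" using border_subset[OF wf_stack_top] by blast
  then show ?case using position_cell[of s v] Nil by auto
next
  case (Cons e es)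
  then have e: "(position s v, label e, target e) \<in> E" "path X E (target e) es y"
    by (cases e; auto simp: source_def target_def label_def)+
  obtain q s' where q: "pda_step (automaton x y) (v, label e # map label es, s) (q, map label es, s')"
    "wf_stack s'" "q \<in> border (stack_top s')" "position s' q = target e"
    by (rule automaton_step_complete[OF Cons(3,4) e(1)])
  then show ?case using Cons.IH[of s' q] e Cons(5) by (auto intro: converse_rtranclp_into_rtranclp)
qed

lemma path_labels: "path X E v es y \<Longrightarrow> map label es \<in> lists \<Sigma>"
proof (induction es arbitrary: v)
  case (Cons e es)
  then have "e \<in> X \<times> \<Sigma> \<times> X" using edges by auto
  then show ?case using Cons by (cases e) (auto simp: label_def)
qed simp

lemma automaton_language:
  assumes x: "x \<in> border None" and y: "y \<in> border None"
  shows "pda_language (automaton x y) = path_language X E x y"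
proof -
  let ?M = "automaton x y"
  \<comment> \<open>The first step can only remove \<open>bottom\<close>. What follows is a run from
    the empty stack, where \<open>position\<close> is the identity and both run lemmas
    apply.\<close>
  have init: "pda_step ?M (x, w, [bottom]) c \<longleftrightarrow> c = (x, w, [])" for w c
  proof
    assume "pda_step ?M (x, w, [bottom]) c"
    then show "c = (x, w, [])"
      by cases (auto simp: automaton_def stack_top_def)
  next
    assume "c = (x, w, [])"
    then show "pda_step ?M (x, w, [bottom]) c"
      using pda_step.silent[of x "[]" ?M x "[bottom]" w] by (simp add: automaton_def stack_top_def)
  qed
  have "(pda_step ?M)\<^sup>*\<^sup>* (x, w, [bottom]) (y, [], []) \<longleftrightarrow> (pda_step ?M)\<^sup>*\<^sup>* (x, w, []) (y, [], [])" for w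
    using converse_rtranclpE[of "pda_step ?M" "(x, w, [bottom])" "(y, [], [])"] init
      converse_rtranclp_into_rtranclp[of "pda_step ?M" "(x, w, [bottom])" "(x, w, [])"]
    by (metis Pair_inject not_Cons_self2)
  moreover have "(pda_step ?M)\<^sup>*\<^sup>* (x, w, []) (y, [], []) \<longleftrightarrow> w \<in> path_language X E x y" for w
    using automaton_run_sound[of x y x w "[]"] automaton_run_complete[of "[]" x _ y x] x y
    by (auto simp: path_language_def wf_stack.Nil)
  moreover have "path_language X E x y \<subseteq> lists \<Sigma>"
    using path_labels unfolding path_language_def by blast
  moreover have "pda_alphabet ?M = \<Sigma>" "pda_final ?M = {y}" "pda_init ?M = x"
    "pda_init_stack ?M = bottom"
    by (simp_all add: automaton_def)
  ultimately show ?thesis unfolding pda_language_def by auto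
qed

end

section \<open>Cones\<close>

lemma path_append: "path A G x es y \<Longrightarrow> path A G y fs z \<Longrightarrow> path A G x (es @ fs) z"
  by (induction es arbitrary: x) auto

lemma path_mono: "path A G x es y \<Longrightarrow> A \<subseteq> A' \<Longrightarrow> G \<subseteq> G' \<Longrightarrow> path A' G' x es y"
  by (induction es arbitrary: x) auto

lemma path_end: "path A G x es y \<Longrightarrow> y \<in> A"
  by (induction es arbitrary: x) auto

locale rooted_graph = labelled_graph \<Sigma> X E
  for \<Sigma> :: "'a set" and X :: "'v set" and E :: "('v, 'a) edge set" +
  fixes F :: "'v set"
  assumes connected: "connected_graph X E"
    and locally_finite: "locally_finite X E"
    and symmetric: "symmetric_graph \<Sigma> E"
    and root_subset: "F \<subseteq> X" and root_finite: "finite F" and root_nonempty: "F \<noteq> {}"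
begin

lemma edge_in: "(x, a, y) \<in> E \<Longrightarrow> x \<in> X \<and> a \<in> \<Sigma> \<and> y \<in> X"
  using edges_subset by auto

lemma edge_sym: "(x, a, y) \<in> E \<Longrightarrow> \<exists>b. (y, b, x) \<in> E"
  using symmetric unfolding symmetric_graph_def by blast

section \<open>Distance to \<open>F\<close> and finiteness of balls\<close>

definition height :: "'v \<Rightarrow> nat" where
  "height x = Min ((\<lambda>y. graph_dist X E x y) ` F)"

abbreviation ball :: "nat \<Rightarrow> 'v set" where
  "ball n \<equiv> graph_ball X E F n"

lemma ball_iff: "x \<in> ball n \<longleftrightarrow> x \<in> X \<and> height x \<le> n"
  by (simp add: graph_ball_def height_def)

text \<open>Connectedness ensures that the least length in \<open>graph_dist\<close> is attained,
  and \<open>Min\<close> is a true minimum because \<open>F\<close> is finite and non-empty.\<close>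

lemma height_le_iff:
  assumes x: "x \<in> X"
  shows "height x \<le> n \<longleftrightarrow> (\<exists>y\<in>F. \<exists>es. path X E x es y \<and> length es \<le> n)"
proof -
  have "graph_dist X E x y \<le> n \<longleftrightarrow> (\<exists>es. path X E x es y \<and> length es \<le> n)" if "y \<in> F" for y
  proof
    have "\<exists>m es. path X E x es y \<and> length es = m"
      using connected x that root_subset unfolding connected_graph_def by blast
    then have "\<exists>es. path X E x es y \<and> length es = graph_dist X E x y"
      unfolding graph_dist_def by (rule LeastI_ex)
    then show "graph_dist X E x y \<le> n \<Longrightarrow> \<exists>es. path X E x es y \<and> length es \<le> n" by auto
  next
    assume "\<exists>es. path X E x es y \<and> length es \<le> n"
    then obtain es where es: "path X E x es y" "length es \<le> n" by auto
    have "graph_dist X E x y \<le> length es"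
      unfolding graph_dist_def using es by (intro Least_le) auto
    with es show "graph_dist X E x y \<le> n" by simp
  qed
  then show ?thesis
    unfolding height_def using root_finite root_nonempty by (simp add: Min_le_iff)
qed

lemma height_edge:
  assumes e: "(x, a, y) \<in> E"
  shows "height x \<le> Suc (height y)"
proof -
  obtain z es where z: "z \<in> F" "path X E y es z" "length es \<le> height y"
    using height_le_iff[of y "height y"] edge_in[OF e] by auto
  then have "path X E x ((x, a, y) # es) z" "length ((x, a, y) # es) \<le> Suc (height y)"
    using e by (simp_all add: source_def target_def)
  then show ?thesis using height_le_iff[of x "Suc (height y)"] edge_in[OF e] z(1) by blast
qed

text \<open>Follow the first edge of a path to \<open>F\<close> of length at most
  \<open>Suc n\<close>; the empty path accounts for the first alternative.\<close>

lemma height_descend: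
  assumes x: "x \<in> X" and h: "height x \<le> Suc n"
  shows "height x = 0 \<and> x \<in> F \<or> (\<exists>a y. (x, a, y) \<in> E \<and> height y \<le> n)"
proof -
  obtain z es where es: "z \<in> F" "path X E x es z" "length es \<le> Suc n"
    using height_le_iff[OF x] h by auto
  show ?thesis
  proof (cases es)
    case Nil
    then show ?thesis using es height_le_iff[OF x, of 0] by auto
  next
    case (Cons e fs)
    obtain a y where e: "e = (x, a, y)" using es Cons by (cases e) (auto simp: source_def)
    then have "(x, a, y) \<in> E" "path X E y fs z" "length fs \<le> n"
      using es Cons by (auto simp: target_def)
    then show ?thesis using height_le_iff[of y n] es(1) edge_in by blast
  qed
qed

lemma finite_edges_at: "finite {e \<in> E. source e = x \<or> target e = x}"
proof (cases "x \<in> X")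
  case False
  then have "{e \<in> E. source e = x \<or> target e = x} = {}"
    using edges_subset by (auto simp: source_def target_def)
  then show ?thesis by (simp only: finite.emptyI)
qed (use locally_finite in \<open>auto simp: locally_finite_def\<close>)

lemma finite_successors: "finite {w. \<exists>a. (u, a, w) \<in> E}"
proof (rule finite_subset)
  show "{w. \<exists>a. (u, a, w) \<in> E} \<subseteq> target ` {e \<in> E. source e = u \<or> target e = u}"
    by (force simp: source_def target_def)
qed (simp add: finite_edges_at)

text \<open>Outside \<open>F\<close>, a vertex of the next ball has an edge into the previous one by
  \<open>height_descend\<close>. Symmetry reverses this edge, so the vertex is one of finitely many
  successors of a finite set.\<close>

lemma finite_ball: "finite (ball n)"
proof (induction n)
  case 0
  have "ball 0 \<subseteq> F" using height_le_iff by (fastforce simp: ball_iff)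
  then show ?case using root_finite finite_subset by blast
next
  case (Suc n)
  have "ball (Suc n) \<subseteq> F \<union> (\<Union>y\<in>ball n. {w. \<exists>a. (y, a, w) \<in> E})"
  proof
    fix x assume x: "x \<in> ball (Suc n)"
    then consider "x \<in> F" | a y where "(x, a, y) \<in> E" "height y \<le> n"
      using height_descend[of x n] by (auto simp: ball_iff)
    then show "x \<in> F \<union> (\<Union>y\<in>ball n. {w. \<exists>a. (y, a, w) \<in> E})"
    proof cases
      case (2 a y)
      then have "y \<in> ball n" "\<exists>b. (y, b, x) \<in> E" using edge_in[OF 2(1)] edge_sym by (simp_all add: ball_iff)
      then show ?thesis by blast
    qed simp
  qed
  moreover have "finite (F \<union> (\<Union>y\<in>ball n. {w. \<exists>a. (y, a, w) \<in> E}))"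
    using Suc root_finite finite_successors by blast
  ultimately show ?case by (rule finite_subset)
qed

section \<open>Components of complements of balls, and their boundaries\<close>

definition reach :: "nat \<Rightarrow> 'v \<Rightarrow> 'v set" where
  "reach n x = {y. \<exists>es. path (X - ball n) (induced_edges E (X - ball n)) x es y}"

lemma cones_iff: "C \<in> cones X E F \<longleftrightarrow> (\<exists>n x. x \<in> X - ball n \<and> C = reach n x)"
  by (auto simp: cones_def components_def quotient_def reach_def Image_def)

lemma reach_cone: "x \<in> X - ball n \<Longrightarrow> reach n x \<in> cones X E F"
  unfolding cones_iff by (intro exI[of _ n] exI[of _ x] conjI) auto

lemma reach_refl: "x \<in> X - ball n \<Longrightarrow> x \<in> reach n x"
  by (auto simp: reach_def intro!: exI[of _ "[]"])

lemma reach_trans: "y \<in> reach n x \<Longrightarrow> z \<in> reach n y \<Longrightarrow> z \<in> reach n x"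
  by (auto simp: reach_def intro: path_append)

lemma reach_subset: "reach n x \<subseteq> X - ball n"
  by (auto simp: reach_def dest: path_end)

lemma reach_edge:
  assumes "y \<in> reach n x" "(y, a, z) \<in> E" "z \<notin> ball n"
  shows "z \<in> reach n x"
proof -
  have "y \<in> X - ball n" "z \<in> X" using assms reach_subset edge_in by auto
  then have "z \<in> reach n y" using assms
    by (auto simp: reach_def induced_edges_def source_def target_def intro!: exI[of _ "[(y, a, z)]"])
  then show ?thesis using assms(1) reach_trans by blast
qed

lemma reach_Suc: "reach (Suc n) x \<subseteq> reach n x"
proof -
  have "X - ball (Suc n) \<subseteq> X - ball n" by (auto simp: ball_iff)
  moreover from this have "induced_edges E (X - ball (Suc n)) \<subseteq> induced_edges E (X - ball n)"
    by (auto simp: induced_edges_def)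
  ultimately show ?thesis unfolding reach_def by (blast intro: path_mono)
qed

text \<open>An edge leaving the component ends in \<open>ball n\<close>, so its source has height at
  most \<open>Suc n\<close>; conversely, \<open>height_descend\<close> gives a vertex of that height
  an edge into \<open>ball n\<close>. Hence boundaries are finite, and the interior of a cone is
  what remains after removing the next ball.\<close>

lemma cone_boundary_reach: "cone_boundary X E (reach n x) = reach n x \<inter> ball (Suc n)"
proof (intro equalityI subsetI)
  fix v assume "v \<in> cone_boundary X E (reach n x)"
  then obtain y b where v: "v \<in> reach n x" and y: "y \<in> X - reach n x"
    and e: "(v, b, y) \<in> E \<or> (y, b, v) \<in> E"
    unfolding cone_boundary_def by blast
  from e obtain c where y2: "(v, c, y) \<in> E" using edge_sym[of y b v] by blast
  have "y \<in> ball n" using reach_edge[OF v y2] y by blast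
  then have "height v \<le> Suc n" using height_edge[OF y2] by (simp add: ball_iff)
  then show "v \<in> reach n x \<inter> ball (Suc n)" using v reach_subset[of n x] by (auto simp: ball_iff)
next
  fix v assume v: "v \<in> reach n x \<inter> ball (Suc n)"
  then have "v \<in> X" "\<not> height v \<le> n" using reach_subset[of n x] by (auto simp: ball_iff)
  then obtain a y where y: "(v, a, y) \<in> E" "height y \<le> n"
    using height_descend[of v n] v by (auto simp: ball_iff)
  then have "y \<in> X - reach n x" using edge_in[OF y(1)] reach_subset[of n x] by (auto simp: ball_iff)
  then show "v \<in> cone_boundary X E (reach n x)" using v y unfolding cone_boundary_def by blast
qed

section \<open>Smaller cones inside a region\<close>

definition subcone :: "'v set \<Rightarrow> 'v set \<Rightarrow> 'v \<Rightarrow> 'v set \<Rightarrow> bool" where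
  "subcone R S w D \<longleftrightarrow> D \<in> cones X E F \<and> w \<in> D \<and> D \<subseteq> R - S \<and>
     (\<forall>u b y. u \<in> D \<longrightarrow> (u, b, y) \<in> E \<longrightarrow> y \<notin> D \<longrightarrow> y \<in> S)"

lemma subcone_root:
  assumes "w \<in> X - ball n"
  shows "subcone X (ball n) w (reach n w)"
proof -
  have "y \<in> ball n" if "u \<in> reach n w" "(u, b, y) \<in> E" "y \<notin> reach n w" for u b y
    using reach_edge[OF that(1,2)] that(3) by blast
  then show ?thesis
    using reach_cone[OF assms] reach_refl[OF assms] reach_subset[of n w]
    unfolding subcone_def by (intro conjI allI impI)
qed

lemma cone_boundary_interior:
  "u \<in> C - cone_boundary X E C \<Longrightarrow> (u, a, w) \<in> E \<Longrightarrow> w \<in> C"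
  using edge_in[of u a w] by (auto simp: cone_boundary_def)

text \<open>The component of \<open>w\<close> after removal of the next ball serves as
  \<open>D\<close>. An edge leaving it starts in the interior of \<open>C\<close>, hence stays in
  \<open>C\<close>, and ends in the next ball, whose intersection with \<open>C\<close> is the
  boundary.\<close>

lemma subcone_cone:
  assumes C: "C \<in> cones X E F" and w: "w \<in> C - cone_boundary X E C"
  shows "\<exists>D. subcone C (cone_boundary X E C) w D"
proof -
  obtain n x where C': "C = reach n x" using C cones_iff by auto
  have bd: "cone_boundary X E C = C \<inter> ball (Suc n)" using cone_boundary_reach C' by simp
  then have w': "w \<in> X - ball (Suc n)" using w reach_subset[of n x] C' by auto
  have sub: "reach (Suc n) w \<subseteq> C" using reach_Suc[of n w] reach_trans[of w n x] w C' by auto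
  have "y \<in> cone_boundary X E C"
    if "u \<in> reach (Suc n) w" "(u, b, y) \<in> E" "y \<notin> reach (Suc n) w" for u b y
  proof -
    have "u \<in> C - cone_boundary X E C" using that(1) sub bd reach_subset[of "Suc n" w] by auto
    then have "y \<in> C" using that(2) by (rule cone_boundary_interior)
    moreover have "y \<in> ball (Suc n)" using reach_edge[OF that(1,2)] that(3) by blast
    ultimately show ?thesis using bd by simp
  qed
  moreover note reach_cone[OF w']
  moreover have "reach (Suc n) w \<subseteq> C - cone_boundary X E C"
    using sub bd reach_subset[of "Suc n" w] by auto
  ultimately have "subcone C (cone_boundary X E C) w (reach (Suc n) w)"
    using reach_refl[OF w'] unfolding subcone_def by (intro conjI allI impI)
  then show ?thesis ..
qed

lemma finite_cone_boundary: "C \<in> cones X E F \<Longrightarrow> finite (cone_boundary X E C)"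
  by (auto simp: cones_iff cone_boundary_reach finite_ball)

lemma cone_nonempty: "C \<in> cones X E F \<Longrightarrow> C \<noteq> {}"
  using reach_refl by (auto simp: cones_iff)

section \<open>Representatives of the isomorphism types\<close>

definition cone_rel :: "('v set \<times> 'v set) set" where
  "cone_rel = {(C, C'). C \<in> cones X E F \<and> C' \<in> cones X E F \<and> cone_isomorphic X E C C'}"

text \<open>The choice is applied to the whole class of \<open>C\<close> and so depends on the class
  alone; finitely many classes then yield finitely many representatives.\<close>

definition cone_rep :: "'v set \<Rightarrow> 'v set" where
  "cone_rep C = (SOME C'. C' \<in> cone_rel `` {C})"

lemma cone_rep:
  assumes "C \<in> cones X E F"
  shows "cone_rep C \<in> cones X E F" "cone_isomorphic X E C (cone_rep C)"
proof -
  have "cone_isomorphic X E C C" unfolding cone_isomorphic_def by (rule exI[of _ id]) auto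
  then have "C \<in> cone_rel `` {C}" using assms by (simp add: cone_rel_def)
  then have "cone_rep C \<in> cone_rel `` {C}" unfolding cone_rep_def by (rule someI)
  then show "cone_rep C \<in> cones X E F" "cone_isomorphic X E C (cone_rep C)"
    by (auto simp: cone_rel_def)
qed

lemma finite_cone_reps:
  assumes "context_free_graph X E F"
  shows "finite (cone_rep ` cones X E F)"
proof -
  have "cone_rep ` cones X E F = (\<lambda>K. SOME C'. C' \<in> K) ` (cones X E F // cone_rel)"
    by (auto simp: cone_rep_def quotient_def image_iff)
  then show ?thesis using assms by (simp add: context_free_graph_def cone_rel_def)
qed

definition cone_iso :: "'v set \<Rightarrow> 'v \<Rightarrow> 'v" where
  "cone_iso C = (SOME f. bij_betw f C (cone_rep C) \<and>
     (\<forall>x\<in>C. \<forall>y\<in>C. \<forall>a. (x, a, y) \<in> E \<longleftrightarrow> (f x, a, f y) \<in> E) \<and>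
     f ` cone_boundary X E C = cone_boundary X E (cone_rep C))"

lemma cone_iso:
  assumes "C \<in> cones X E F"
  shows "bij_betw (cone_iso C) C (cone_rep C)"
    "\<And>x y a. x \<in> C \<Longrightarrow> y \<in> C \<Longrightarrow> (x, a, y) \<in> E \<longleftrightarrow> (cone_iso C x, a, cone_iso C y) \<in> E"
    "cone_iso C ` cone_boundary X E C = cone_boundary X E (cone_rep C)"
  using someI_ex[OF cone_rep(2)[OF assms, unfolded cone_isomorphic_def]]
  unfolding cone_iso_def[symmetric] by blast+

definition cone_emb :: "'v set \<Rightarrow> 'v \<Rightarrow> 'v" where
  "cone_emb C = inv_into C (cone_iso C)"

lemma cone_emb:
  assumes C: "C \<in> cones X E F"
  shows "cone_emb C ` cone_rep C = C"
    "\<And>v. v \<in> cone_rep C \<Longrightarrow> cone_emb C v \<in> C \<and> cone_iso C (cone_emb C v) = v"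
  using bij_betw_inv_into[OF cone_iso(1)[OF C]] bij_betw_inv_into_right[OF cone_iso(1)[OF C]]
  unfolding cone_emb_def bij_betw_def by auto

section \<open>Cones as a system of nested regions\<close>

definition region :: "'v set option \<Rightarrow> 'v set" where
  "region t = (case t of None \<Rightarrow> X | Some C \<Rightarrow> cone_rep C)"

definition border :: "nat \<Rightarrow> 'v set option \<Rightarrow> 'v set" where
  "border n t = (case t of None \<Rightarrow> ball n | Some C \<Rightarrow> cone_boundary X E (cone_rep C))"

text \<open>The choice sees \<open>t\<close> only through its region and border, so cones with the
  same representative share their children. The finiteness of the stack alphabet rests on
  this.\<close>

definition child :: "nat \<Rightarrow> 'v set option \<Rightarrow> 'v \<Rightarrow> 'v set" where
  "child n t w = (SOME D. subcone (region t) (border n t) w D)"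

lemma child:
  assumes "t \<in> insert None (Some ` cones X E F)" "w \<in> region t - border n t"
  shows "subcone (region t) (border n t) w (child n t w)"
proof -
  have "\<exists>D. subcone (region t) (border n t) w D"
  proof (cases t)
    case None
    then show ?thesis using assms subcone_root[of w n] by (auto simp: region_def border_def)
  next
    case (Some C)
    then show ?thesis using assms subcone_cone[OF cone_rep(1), of C w]
      by (auto simp: region_def border_def)
  qed
  then show ?thesis unfolding child_def by (rule someI_ex)
qed

text \<open>Letting \<open>t\<close> range over all cones avoids a recursive definition: every
  symbol is itself a cone, so the set is closed under taking children across an edge from the
  border.\<close>

definition symbols :: "nat \<Rightarrow> 'v set set" where
  "symbols n = {child n t w |t v a w. t \<in> insert None (Some ` cones X E F) \<and>
     v \<in> border n t \<and> (v, a, w) \<in> E \<and> w \<in> region t - border n t}"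

lemma symbols_cones: "symbols n \<subseteq> cones X E F"
  using child unfolding symbols_def subcone_def by blast

lemma finite_border: "t \<in> insert None (Some ` cones X E F) \<Longrightarrow> finite (border n t)"
  using finite_ball finite_cone_boundary cone_rep(1) by (auto simp: border_def)

text \<open>There are finitely many pairs of a region and its border, each border is finite, and a
  border vertex has finitely many successors.\<close>

lemma finite_symbols:
  assumes "context_free_graph X E F"
  shows "finite (symbols n)"
proof -
  define frames where
    "frames = (\<lambda>t. (region t, border n t)) ` insert None (Some ` cones X E F)"
  \<comment> \<open>This is the choice made by \<open>child\<close>, rewritten as a function of the
    pair of region and border, since \<open>t\<close> itself may take infinitely many
    values.\<close>
  define sub where "sub = (\<lambda>(R, S) w. SOME D. subcone R S w D)"
  have "frames = insert (X, ball n)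
      ((\<lambda>C. (C, cone_boundary X E C)) ` cone_rep ` cones X E F)"
    by (simp add: frames_def region_def border_def image_image)
  then have "finite frames" using finite_cone_reps[OF assms] by simp
  moreover have "finite (snd f)" if "f \<in> frames" for f
    using that finite_border unfolding frames_def by fastforce
  ultimately have "finite (\<Union>f\<in>frames. \<Union>v\<in>snd f. sub f ` {w. \<exists>a. (v, a, w) \<in> E})"
    using finite_successors by blast
  moreover have "symbols n \<subseteq> (\<Union>f\<in>frames. \<Union>v\<in>snd f. sub f ` {w. \<exists>a. (v, a, w) \<in> E})"
  proof
    fix D assume "D \<in> symbols n"
    then obtain t v a w where D: "D = child n t w" and t: "t \<in> insert None (Some ` cones X E F)"
      and v: "v \<in> border n t" "(v, a, w) \<in> E"
      unfolding symbols_def by blast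
    from t have "(region t, border n t) \<in> frames" unfolding frames_def by (rule imageI)
    moreover have "D = sub (region t, border n t) w" by (simp add: D sub_def child_def)
    ultimately show "D \<in> (\<Union>f\<in>frames. \<Union>v\<in>snd f. sub f ` {w. \<exists>a. (v, a, w) \<in> E})"
      using v by force
  qed
  ultimately show ?thesis using finite_subset by blast
qed

lemma nested_regions_cones:
  assumes "context_free_graph X E F"
  shows "nested_regions \<Sigma> X E (symbols n) region (border n) cone_emb (child n) {}"
proof
  have top: "t \<in> insert None (Some ` cones X E F)" if "t \<in> insert None (Some ` symbols n)" for t
    using that symbols_cones by blast
  show "finite {w. (u, a, w) \<in> E}" for u a
    using finite_successors[of u] by (rule rev_finite_subset) auto
  \<comment> \<open>The empty set can play the role of \<open>bottom\<close> because cones are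
    non-empty.\<close>
  show "{} \<notin> symbols n" using symbols_cones cone_nonempty by blast
  show "finite (border n t)" if "t \<in> insert None (Some ` symbols n)" for t
    using finite_border top[OF that] .
  show "border n t \<subseteq> region t" for t
    by (cases t) (auto simp: border_def region_def ball_iff cone_boundary_def)
  show "w \<in> region t" if "u \<in> region t - border n t" "(u, a, w) \<in> E" for t u a w
    using that edge_in[OF that(2)] cone_boundary_interior[of u _ a w]
    by (cases t) (simp_all add: border_def region_def)
  show "(cone_emb z v, a, cone_emb z w) \<in> E \<longleftrightarrow> (v, a, w) \<in> E"
    if "z \<in> symbols n" "v \<in> region (Some z)" "w \<in> region (Some z)" for z v w a
  proof -
    have "z \<in> cones X E F" using that symbols_cones by auto
    then show ?thesis using cone_iso(2) cone_emb(2) that by (simp add: region_def)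
  qed
  show "v \<in> border n (Some z)"
    if "z \<in> symbols n" "v \<in> region (Some z)" "y \<notin> cone_emb z ` region (Some z)"
      "(cone_emb z v, a, y) \<in> E \<or> (y, a, cone_emb z v) \<in> E" for z v y a
  proof -
    have z: "z \<in> cones X E F" using that symbols_cones by auto
    \<comment> \<open>The image of \<open>cone_emb z\<close> is \<open>z\<close> itself, so the
      given edge joins the image of \<open>v\<close> to a vertex outside the cone \<open>z\<close>;
      the isomorphism then carries boundary to boundary.\<close>
    then have "cone_emb z v \<in> cone_boundary X E z"
      using that cone_emb[OF z] edge_in unfolding cone_boundary_def region_def by auto
    then have "cone_iso z (cone_emb z v) \<in> cone_boundary X E (cone_rep z)"
      using cone_iso(3)[OF z] by blast
    then show ?thesis using cone_emb(2)[OF z] that(2) by (simp add: border_def region_def)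
  qed
  show "child n t w \<in> symbols n \<and>
      w \<in> cone_emb (child n t w) ` region (Some (child n t w)) \<and>
      cone_emb (child n t w) ` region (Some (child n t w)) \<subseteq> region t - border n t \<and>
      (\<forall>u b y. u \<in> cone_emb (child n t w) ` region (Some (child n t w)) \<longrightarrow> (u, b, y) \<in> E \<longrightarrow>
        y \<notin> cone_emb (child n t w) ` region (Some (child n t w)) \<longrightarrow> y \<in> border n t)"
    if t: "t \<in> insert None (Some ` symbols n)" and "v \<in> border n t" "(v, a, w) \<in> E"
      "w \<in> region t - border n t" for t v a w
  proof -
    have D: "subcone (region t) (border n t) w (child n t w)" using child top[OF t] that(4) .
    then have "cone_emb (child n t w) ` region (Some (child n t w)) = child n t w"
      using cone_emb(1) by (simp add: region_def subcone_def)
    moreover have "child n t w \<in> symbols n" using that top[OF t] unfolding symbols_def by blast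
    ultimately show ?thesis using D unfolding subcone_def by simp
  qed
qed (use finite_alphabet edges_subset finite_symbols[OF assms] in \<open>auto simp: region_def\<close>)

lemma path_language_pda:
  assumes cf: "context_free_graph X E F" and x: "x \<in> X" and y: "y \<in> X"
  shows "\<exists>M :: (nat, 'a, nat) pda. pda M \<and> pda_alphabet M = \<Sigma> \<and>
    pda_language M = path_language X E x y \<and> (deterministic_graph X E \<longrightarrow> deterministic_pda M)"
proof -
  \<comment> \<open>This radius puts both vertices into \<open>ball n\<close>, the border belonging
    to the empty stack.\<close>
  define n where "n = max (height x) (height y)"
  interpret nested_regions \<Sigma> X E "symbols n" region "border n" cone_emb "child n" "{}"
    using nested_regions_cones[OF cf] .
  have xy: "x \<in> border n None" "y \<in> border n None"
    using x y by (simp_all add: border_def ball_iff n_def)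
  have "deterministic_pda (automaton x y)" if "deterministic_graph X E"
  proof (rule deterministic_automaton)
    fix u a w w'
    assume e: "(u, a, w) \<in> E" "(u, a, w') \<in> E"
    then have "inj_on label {e \<in> E. source e = u}"
      using that edge_in unfolding deterministic_graph_def by blast
    from inj_onD[OF this, of "(u, a, w)" "(u, a, w')"] e show "w = w'"
      by (simp add: label_def source_def)
  qed
  moreover have "pda_alphabet (automaton x y) = \<Sigma>" by (simp add: automaton_def)
  ultimately show ?thesis
    using pda_encode_nat[OF pda_automaton[OF xy]] unfolding automaton_language[OF xy] by auto
qed

end

theorem theorem4p2:
  fixes \<Sigma> :: "'a set" and X :: "'v set" and E :: "('v, 'a) edge set" and F :: "'v set"
  assumes "labelled_graph \<Sigma> X E"
    and "connected_graph X E"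
    and "locally_finite X E"
    and "symmetric_graph \<Sigma> E"
    and "F \<subseteq> X" and "finite F" and "F \<noteq> {}"
    and "context_free_graph X E F"
  shows "(\<forall>x\<in>X. \<forall>y\<in>X. context_free_language \<Sigma> (path_language X E x y)) \<and>
    (deterministic_graph X E \<longrightarrow>
      (\<forall>x\<in>X. \<forall>y\<in>X. deterministic_context_free_language \<Sigma> (path_language X E x y)))"
proof -
  interpret rooted_graph \<Sigma> X E F
    using assms(1-7) by (intro rooted_graph.intro rooted_graph_axioms.intro)
  show ?thesis
  proof (intro conjI impI ballI)
    fix x y assume "x \<in> X" "y \<in> X"
    then obtain M :: "(nat, 'a, nat) pda"
      where M: "pda M" "pda_alphabet M = \<Sigma>" "pda_language M = path_language X E x y"
        "deterministic_graph X E \<longrightarrow> deterministic_pda M"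
      using path_language_pda[OF assms(8)] by blast
    then show "context_free_language \<Sigma> (path_language X E x y)"
      unfolding context_free_language_def by blast
    assume "deterministic_graph X E"
    with M show "deterministic_context_free_language \<Sigma> (path_language X E x y)"
      unfolding deterministic_context_free_language_def by blast
  qed
qed

end
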